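(* Let $\lambda_1,\dots,\lambda_n\in\mathbb C$ and assume that the four real vectors \[ (1)_{i=1}^n,\qquad(\operatorname{Re}\lambda_i)_{i=1}^n,\qquad(\operatorname{Im}\lambda_i)_{i=1}^n,\qquad(|\lambda_i|^2)_{i=1}^n \] are linearly independent. If $c=(c_1,\dots,c_n)\in\mathbb R^n$ satisfies \[ \sum_ic_i=0,\qquad\sum_ic_i\lambda_i=0,\qquad\sum_ic_i|\lambda_i|^2=0, \] then, on the interior of the simplex, $I_c(p)=\sum_ic_i\log p_i$ is constant along the residual flow. Equivalently, $\prod_ip_i^{c_i}=\mathrm{const}$ along the flow. The space of such first integrals has dimension $n-4$.
   Context: The residual flow on the simplex $\Delta^{n-1}=\{p\in\mathbb R^n:p_i\ge0,\ \sum_ip_i=1\}$ is \[ \dot p_i=4p_i\left(\rho(p)-|\lambda_i-z(p)|^2\right),\qquad z(p)=\sum_jp_j\lambda_j,\quad \rho(p)=\sum_jp_j|\lambda_j-z(p)|^2 . \] The interior of the simplex is the set where all $p_i>0$. *)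

theory Defs
  imports "HOL-Analysis.Analysis" "HOL-Library.Function_Algebras"
begin

definition std_simplex :: "(real ^ 'n) set" where
  "std_simplex = {p. (\<forall>i. 0 \<le> p $ i) \<and> (\<Sum>i\<in>UNIV. p $ i) = 1}"

text \<open>The relative interior; the topological \<open>interior\<close> in the ambient space is empty.\<close>

definition simplex_interior :: "(real ^ 'n) set" where
  "simplex_interior = {p \<in> std_simplex. \<forall>i. 0 < p $ i}"

definition centroid :: "complex ^ 'n \<Rightarrow> real ^ 'n \<Rightarrow> complex" where
  "centroid lam p = (\<Sum>j\<in>UNIV. of_real (p $ j) * lam $ j)"

definition spread :: "complex ^ 'n \<Rightarrow> real ^ 'n \<Rightarrow> real" where
  "spread lam p = (\<Sum>j\<in>UNIV. p $ j * (cmod (lam $ j - centroid lam p))\<^sup>2)"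

definition residual_field :: "complex ^ 'n \<Rightarrow> real ^ 'n \<Rightarrow> real ^ 'n" where
  "residual_field lam p =
     (\<chi> i. 4 * p $ i * (spread lam p - (cmod (lam $ i - centroid lam p))\<^sup>2))"

text \<open>A trajectory of the residual flow in \<open>X\<close>, on an arbitrary time interval
  (open or not, bounded or not); at an endpoint of the interval contained in it
  the derivative is one-sided.\<close>

definition residual_solution ::
  "complex ^ 'n \<Rightarrow> (real ^ 'n) set \<Rightarrow> real set \<Rightarrow> (real \<Rightarrow> real ^ 'n) \<Rightarrow> bool" where
  "residual_solution lam X T p \<longleftrightarrow> is_interval T \<and>
     (\<forall>t\<in>T. p t \<in> X \<and> (p has_vector_derivative residual_field lam (p t)) (at t within T))"

definition first_integral_on ::
  "(real ^ 'n) set \<Rightarrow> complex ^ 'n \<Rightarrow> (real ^ 'n \<Rightarrow> real) \<Rightarrow> bool" where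
  "first_integral_on X lam F \<longleftrightarrow>
     (\<forall>T p. residual_solution lam X T p \<longrightarrow> (\<lambda>t. F (p t)) constant_on T)"

definition log_integral :: "real ^ 'n \<Rightarrow> real ^ 'n \<Rightarrow> real" where
  "log_integral c p = (\<Sum>i\<in>UNIV. c $ i * ln (p $ i))"

definition coefficient_space :: "complex ^ 'n \<Rightarrow> (real ^ 'n) set" where
  "coefficient_space lam = {c. (\<Sum>i\<in>UNIV. c $ i) = 0 \<and>
     (\<Sum>i\<in>UNIV. of_real (c $ i) * lam $ i) = 0 \<and>
     (\<Sum>i\<in>UNIV. c $ i * (cmod (lam $ i))\<^sup>2) = 0}"

text \<open>Real functions on a set \<open>X\<close> are represented by their extensions by zero, so that
  equality of representatives is equality on \<open>X\<close>, and the values which \<^const>\<open>log_integral\<close>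
  happens to take elsewhere are irrelevant.\<close>

definition zero_extend :: "'a set \<Rightarrow> ('a \<Rightarrow> real) \<Rightarrow> 'a \<Rightarrow> real" where
  "zero_extend X f = (\<lambda>x. if x \<in> X then f x else 0)"

definition log_integral_space :: "complex ^ 'n \<Rightarrow> (real ^ 'n \<Rightarrow> real) set" where
  "log_integral_space lam =
     (\<lambda>c. zero_extend simplex_interior (log_integral c)) ` coefficient_space lam"

definition fun_scale :: "real \<Rightarrow> ('a \<Rightarrow> real) \<Rightarrow> 'a \<Rightarrow> real" where
  "fun_scale r f = (\<lambda>x. r * f x)"

global_interpretation fun_space: vector_space fun_scale
  by standard (auto simp: fun_scale_def fun_eq_iff algebra_simps)

end

theory Submission
  imports Defs
begin

text \<open>
  Along the flow, each \<open>ln (p $ i)\<close> has derivative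
  \<open>4 * (spread - \<bar>lam i - z\<bar>\<^sup>2)\<close>.  Expanding the square,
  \<open>\<bar>lam i - z\<bar>\<^sup>2 = \<bar>lam i\<bar>\<^sup>2 - 2 Re z Re (lam i) - 2 Im z Im (lam i) + \<bar>z\<bar>\<^sup>2\<close>,
  so as a vector in \<open>i\<close> this growth rate is, at every point, a combination of the four fixed
  vectors \<open>1\<close>, \<open>Re lam\<close>, \<open>Im lam\<close>, \<open>\<bar>lam\<bar>\<^sup>2\<close> whose coefficients depend on the point.
  The conditions on \<open>c\<close> say exactly that \<open>c\<close> is orthogonal to these vectors, hence the derivative
  of \<open>\<Sum> c i * ln (p i)\<close> vanishes (\<open>residual_growth_annihilated\<close>); the product is the
  exponential of this sum.

  For the dimension, the admissible \<open>c\<close> form the orthogonal complement of a space spanned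
  by four independent vectors, which has dimension \<open>n - 4\<close>
  (\<open>dim_coefficient_space\<close>).  It remains to see that distinct \<open>c\<close> give distinct functions on
  the open simplex.  For \<open>c\<close> with coefficient sum zero, \<open>log_integral c\<close> is invariant under
  scaling of \<open>p\<close>, so it may be evaluated at the point with homogeneous coordinates \<open>e\<close> in place
  \<open>k\<close> and \<open>1\<close> elsewhere; there its value is \<open>c $ k\<close> (\<open>log_integral_recovers_coefficient\<close>).
\<close>

section \<open>Constancy along the flow\<close>

text \<open>The square is a quadratic in \<open>lam $ i\<close> whose leading coefficient is constant; expanding it
  around \<open>0\<close> leaves one sum for each condition on \<open>c\<close>, the complex condition giving a real
  and an imaginary one.\<close>

lemma residual_growth_annihilated:
  fixes lam :: "complex ^ 'n"
  assumes "c \<in> coefficient_space lam"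
  shows "(\<Sum>i\<in>UNIV. c $ i * (r - (cmod (lam $ i - z))\<^sup>2)) = 0"
proof -
  have s0: "(\<Sum>i\<in>UNIV. c $ i) = 0"
    and s1: "(\<Sum>i\<in>UNIV. of_real (c $ i) * lam $ i) = 0"
    and s2: "(\<Sum>i\<in>UNIV. c $ i * (cmod (lam $ i))\<^sup>2) = 0"
    using assms by (auto simp: coefficient_space_def)
  from s1 have sR: "(\<Sum>i\<in>UNIV. c $ i * Re (lam $ i)) = 0"
    and sI: "(\<Sum>i\<in>UNIV. c $ i * Im (lam $ i)) = 0"
    by (simp_all add: complex_eq_iff)
  have "c $ i * (r - (cmod (lam $ i - z))\<^sup>2) =
      (r - (cmod z)\<^sup>2) * c $ i + 2 * Re z * (c $ i * Re (lam $ i))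
      + 2 * Im z * (c $ i * Im (lam $ i)) - c $ i * (cmod (lam $ i))\<^sup>2" for i
    unfolding cmod_power2 by (simp add: power2_eq_square algebra_simps)
  then have "(\<Sum>i\<in>UNIV. c $ i * (r - (cmod (lam $ i - z))\<^sup>2)) =
      (r - (cmod z)\<^sup>2) * (\<Sum>i\<in>UNIV. c $ i) + 2 * Re z * (\<Sum>i\<in>UNIV. c $ i * Re (lam $ i))
      + 2 * Im z * (\<Sum>i\<in>UNIV. c $ i * Im (lam $ i)) - (\<Sum>i\<in>UNIV. c $ i * (cmod (lam $ i))\<^sup>2)"
    by (simp add: sum.distrib sum_subtractf sum_distrib_left)
  then show ?thesis
    by (simp add: s0 sR sI s2)
qed

lemma has_vector_derivative_log_integral:
  assumes der: "(p has_vector_derivative v) (at t within T)"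
    and pos: "\<And>i. 0 < p t $ i"
  shows "((\<lambda>s. log_integral c (p s)) has_vector_derivative (\<Sum>i\<in>UNIV. c $ i * (v $ i / p t $ i)))
           (at t within T)"
proof -
  have comp: "((\<lambda>s. p s $ i) has_field_derivative v $ i) (at t within T)" for i
    using bounded_linear.has_vector_derivative[OF bounded_linear_vec_nth der]
    by (simp add: has_real_derivative_iff_has_vector_derivative)
  have "((\<lambda>s. \<Sum>i\<in>UNIV. c $ i * ln (p s $ i)) has_field_derivative
          (\<Sum>i\<in>UNIV. c $ i * (v $ i / p t $ i))) (at t within T)"
    using pos by (auto intro!: derivative_eq_intros comp sum.cong)
  then show ?thesis
    by (simp add: log_integral_def has_real_derivative_iff_has_vector_derivative)
qed

lemma first_integral_log_integral:
  fixes lam :: "complex ^ 'n"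
  assumes c: "c \<in> coefficient_space lam"
  shows "first_integral_on simplex_interior lam (log_integral c)"
  unfolding first_integral_on_def
proof (intro allI impI)
  fix T :: "real set" and p :: "real \<Rightarrow> real ^ 'n"
  assume sol: "residual_solution lam simplex_interior T p"
  have "((\<lambda>s. log_integral c (p s)) has_vector_derivative 0) (at t within T)" if t: "t \<in> T" for t
  proof -
    have pos: "0 < p t $ i" for i
      using sol t by (auto simp: residual_solution_def simplex_interior_def)
    let ?r = "spread lam (p t)" and ?z = "centroid lam (p t)"
    have "c $ i * (residual_field lam (p t) $ i / p t $ i)
        = 4 * (c $ i * (?r - (cmod (lam $ i - ?z))\<^sup>2))" for i
      using pos[of i] by (simp add: residual_field_def)
    then have "(\<Sum>i\<in>UNIV. c $ i * (residual_field lam (p t) $ i / p t $ i))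
        = 4 * (\<Sum>i\<in>UNIV. c $ i * (?r - (cmod (lam $ i - ?z))\<^sup>2))"
      by (simp add: sum_distrib_left)
    then have "(\<Sum>i\<in>UNIV. c $ i * (residual_field lam (p t) $ i / p t $ i)) = 0"
      by (simp only: residual_growth_annihilated[OF c] mult_zero_right)
    moreover have "(p has_vector_derivative residual_field lam (p t)) (at t within T)"
      using sol t by (auto simp: residual_solution_def)
    ultimately show ?thesis
      using has_vector_derivative_log_integral pos by metis
  qed
  moreover have "convex T"
    using sol by (simp add: residual_solution_def is_interval_convex)
  ultimately have "\<exists>k. \<forall>t\<in>T. log_integral c (p t) = k"
    by (intro has_derivative_zero_constant) (auto simp: has_vector_derivative_def)
  then show "(\<lambda>t. log_integral c (p t)) constant_on T"
    by (auto simp: constant_on_def)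
qed

lemma first_integral_on_cong:
  assumes "\<And>p. p \<in> X \<Longrightarrow> F p = G p"
  shows "first_integral_on X lam F \<longleftrightarrow> first_integral_on X lam G"
  using assms unfolding first_integral_on_def residual_solution_def constant_on_def
  by (metis (no_types, lifting))

lemma first_integral_on_compose:
  "first_integral_on X lam F \<Longrightarrow> first_integral_on X lam (\<lambda>p. g (F p))"
  unfolding first_integral_on_def constant_on_def by metis

lemma prod_powr_eq_exp_log_integral:
  assumes "p \<in> simplex_interior"
  shows "(\<Prod>i\<in>UNIV. (p $ i) powr (c $ i)) = exp (log_integral c p)"
proof -
  have "p $ i \<noteq> 0" for i
    using assms by (auto simp: simplex_interior_def less_le)
  then show ?thesis
    by (simp add: log_integral_def exp_sum powr_def)
qed

section \<open>Dimension of the space of coefficients\<close>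

lemma coefficient_space_eq_orthogonal:
  fixes lam :: "complex ^ 'n"
  shows "coefficient_space lam =
    {c. \<forall>x\<in>{(\<chi> i. 1), (\<chi> i. Re (lam $ i)), (\<chi> i. Im (lam $ i)), (\<chi> i. (cmod (lam $ i))\<^sup>2)}.
       orthogonal x c}"
  by (auto simp: coefficient_space_def orthogonal_def inner_vec_def complex_eq_iff mult.commute)

lemma subspace_coefficient_space: "subspace (coefficient_space lam)"
  unfolding coefficient_space_eq_orthogonal by (rule subspace_orthogonal_to_vectors)

lemma dim_orthogonal_complement:
  fixes S :: "'a::euclidean_space set"
  shows "dim {y. \<forall>x\<in>S. orthogonal x y} + dim S = DIM('a)"
proof -
  have "{y. \<forall>x\<in>S. orthogonal x y} = {y \<in> UNIV. \<forall>x\<in>span S. orthogonal x y}"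
    by (auto simp: orthogonal_commute intro: orthogonal_to_span span_base)
  then show ?thesis
    using dim_subspace_orthogonal_to_vectors[of "span S" UNIV] by simp
qed

lemma dim_coefficient_space:
  fixes lam :: "complex ^ 'n"
  assumes "distinct [(\<chi> i. 1), (\<chi> i. Re (lam $ i)), (\<chi> i. Im (lam $ i)),
                     (\<chi> i. (cmod (lam $ i))\<^sup>2) :: real ^ 'n]"
    and "independent {(\<chi> i. 1), (\<chi> i. Re (lam $ i)), (\<chi> i. Im (lam $ i)),
                      (\<chi> i. (cmod (lam $ i))\<^sup>2) :: real ^ 'n}"
  shows "dim (coefficient_space lam) + 4 = CARD('n)"
proof -
  have "dim {(\<chi> i. 1), (\<chi> i. Re (lam $ i)), (\<chi> i. Im (lam $ i)),
              (\<chi> i. (cmod (lam $ i))\<^sup>2) :: real ^ 'n} = 4"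
    using dim_eq_card_independent[OF assms(2)] distinct_card[OF assms(1)] by simp
  then show ?thesis
    using dim_orthogonal_complement[of "{(\<chi> i. 1), (\<chi> i. Re (lam $ i)), (\<chi> i. Im (lam $ i)),
              (\<chi> i. (cmod (lam $ i))\<^sup>2) :: real ^ 'n}"]
    by (simp add: coefficient_space_eq_orthogonal)
qed

section \<open>From coefficients to functions on the open simplex\<close>

lemma linear_zero_extend_log_integral:
  "Vector_Spaces.linear scaleR fun_scale (\<lambda>c. zero_extend X (log_integral c))"
  by (auto simp: Vector_Spaces.linear_iff real_vector.vector_space_axioms
      fun_space.vector_space_axioms zero_extend_def log_integral_def fun_scale_def fun_eq_iff
      sum.distrib sum_distrib_left algebra_simps)

text \<open>The normalising factor of \<open>q\<close> contributes \<open>ln s\<close> with weight \<open>\<Sum>i. c $ i = 0\<close>, and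
  among the homogeneous coordinates only \<open>ln (exp 1)\<close> in place \<open>k\<close> is nonzero.\<close>

lemma log_integral_recovers_coefficient:
  fixes k :: "'n::finite"
  obtains q :: "real ^ 'n" where "q \<in> simplex_interior"
    and "\<And>c. (\<Sum>i\<in>UNIV. c $ i) = 0 \<Longrightarrow> log_integral c q = c $ k"
proof
  define w :: "'n \<Rightarrow> real" where "w i = exp (if i = k then 1 else 0)" for i
  define s where "s = (\<Sum>i\<in>UNIV. w i)"
  let ?q = "\<chi> i. w i / s"
  have w: "0 < w i" for i
    by (simp add: w_def)
  have s: "0 < s"
    unfolding s_def by (intro sum_pos) (auto simp: w)
  show "?q \<in> simplex_interior"
    using s w by (auto simp: simplex_interior_def std_simplex_def less_imp_le
        simp flip: sum_divide_distrib s_def)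
  show "log_integral c ?q = c $ k" if c: "(\<Sum>i\<in>UNIV. c $ i) = 0" for c
  proof -
    have "log_integral c ?q = (\<Sum>i\<in>UNIV. c $ i * (if i = k then 1 else 0) - ln s * c $ i)"
      unfolding log_integral_def
    proof (rule sum.cong)
      show "c $ i * ln (?q $ i) = c $ i * (if i = k then 1 else 0) - ln s * c $ i" for i
        using s w[of i] by (simp add: ln_div) (simp add: w_def algebra_simps)
    qed simp
    also have "\<dots> = c $ k - ln s * (\<Sum>i\<in>UNIV. c $ i)"
      by (simp add: sum_subtractf if_distrib[of "(*) _"] cong: if_cong flip: sum_distrib_left)
    finally show ?thesis
      by (simp add: c)
  qed
qed

lemma inj_on_zero_extend_log_integral:
  "inj_on (\<lambda>c. zero_extend simplex_interior (log_integral c)) (coefficient_space lam)"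
proof (rule inj_onI)
  fix c d
  assume c: "c \<in> coefficient_space lam" and d: "d \<in> coefficient_space lam"
    and eq: "zero_extend simplex_interior (log_integral c)
           = zero_extend simplex_interior (log_integral d)"
  have "c $ k = d $ k" for k
  proof -
    obtain q where q: "q \<in> simplex_interior"
      and rec: "\<And>c. (\<Sum>i\<in>UNIV. c $ i) = 0 \<Longrightarrow> log_integral c q = c $ k"
      using log_integral_recovers_coefficient[of k] by blast
    have "log_integral c q = log_integral d q"
      using fun_cong[OF eq, of q] q by (simp add: zero_extend_def)
    then show ?thesis
      using c d rec by (simp add: coefficient_space_def)
  qed
  then show "c = d"
    by (simp add: vec_eq_iff)
qed

text \<open>The space of all real functions is infinite-dimensional, so images and dimensions are
  transported by the variant of the theory in which only the source has a finite basis; the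
  rewrites identify its notions on the source with the usual Euclidean ones.\<close>

interpretation euclidean_to_fun:
  finite_dimensional_vector_space_pair_1
    "scaleR :: real \<Rightarrow> 'a::euclidean_space \<Rightarrow> 'a" Basis "fun_scale :: real \<Rightarrow> ('b \<Rightarrow> real) \<Rightarrow> _"
  rewrites "module.subspace scaleR = subspace"
    and "module.span scaleR = span"
    and "vector_space.dim scaleR = dim"
  by unfold_locales (simp_all add: subspace_raw_def span_raw_def dim_raw_def)

lemma subspace_log_integral_space: "fun_space.subspace (log_integral_space lam)"
  unfolding log_integral_space_def
  by (rule euclidean_to_fun.linear_subspace_image[OF linear_zero_extend_log_integral
        subspace_coefficient_space])

lemma log_integral_space_finitely_spanned:
  "\<exists>B. finite B \<and> log_integral_space lam \<subseteq> fun_space.span B"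
proof -
  obtain B where B: "independent B" "coefficient_space lam \<subseteq> span B"
    using basis_exists by blast
  let ?L = "\<lambda>c. zero_extend simplex_interior (log_integral c)"
  have "?L ` span B = fun_space.span (?L ` B)"
    by (rule euclidean_to_fun.linear_span_image[OF linear_zero_extend_log_integral, symmetric])
  with B show ?thesis
    unfolding log_integral_space_def
    by (intro exI[of _ "?L ` B"]) (auto dest: finiteI_independent)
qed

lemma dim_log_integral_space:
  "fun_space.dim (log_integral_space lam) = dim (coefficient_space lam)"
  unfolding log_integral_space_def
  by (rule euclidean_to_fun.dim_image_eq[OF linear_zero_extend_log_integral])
    (simp add: span_eq_iff[THEN iffD2, OF subspace_coefficient_space]
      inj_on_zero_extend_log_integral)

theorem proposition4p2:
  fixes lam :: "complex ^ 'n"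
  assumes "distinct [(\<chi> i. 1), (\<chi> i. Re (lam $ i)), (\<chi> i. Im (lam $ i)),
                     (\<chi> i. (cmod (lam $ i))\<^sup>2) :: real ^ 'n]"
    and "independent {(\<chi> i. 1), (\<chi> i. Re (lam $ i)), (\<chi> i. Im (lam $ i)),
                      (\<chi> i. (cmod (lam $ i))\<^sup>2) :: real ^ 'n}"
  shows "(\<forall>c :: real ^ 'n.
            (\<Sum>i\<in>UNIV. c $ i) = 0 \<longrightarrow>
            (\<Sum>i\<in>UNIV. of_real (c $ i) * lam $ i) = 0 \<longrightarrow>
            (\<Sum>i\<in>UNIV. c $ i * (cmod (lam $ i))\<^sup>2) = 0 \<longrightarrow>
              first_integral_on simplex_interior lam (log_integral c) \<and>
              first_integral_on simplex_interior lam (\<lambda>p. \<Prod>i\<in>UNIV. (p $ i) powr (c $ i)))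
       \<and> fun_space.subspace (log_integral_space lam)
       \<and> (\<exists>B. finite B \<and> log_integral_space lam \<subseteq> fun_space.span B)
       \<and> int (fun_space.dim (log_integral_space lam)) = int CARD('n) - 4"
proof (intro conjI allI impI)
  fix c :: "real ^ 'n"
  assume "(\<Sum>i\<in>UNIV. c $ i) = 0" "(\<Sum>i\<in>UNIV. of_real (c $ i) * lam $ i) = 0"
    "(\<Sum>i\<in>UNIV. c $ i * (cmod (lam $ i))\<^sup>2) = 0"
  then have "c \<in> coefficient_space lam"
    by (simp add: coefficient_space_def)
  then show log: "first_integral_on simplex_interior lam (log_integral c)"
    by (rule first_integral_log_integral)
  show "first_integral_on simplex_interior lam (\<lambda>p. \<Prod>i\<in>UNIV. (p $ i) powr (c $ i))"
    using first_integral_on_compose[OF log, of exp]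
    by (simp add: prod_powr_eq_exp_log_integral cong: first_integral_on_cong)
next
  show "fun_space.subspace (log_integral_space lam)"
    by (rule subspace_log_integral_space)
  show "\<exists>B. finite B \<and> log_integral_space lam \<subseteq> fun_space.span B"
    by (rule log_integral_space_finitely_spanned)
  show "int (fun_space.dim (log_integral_space lam)) = int CARD('n) - 4"
    using dim_coefficient_space[OF assms] by (simp add: dim_log_integral_space)
qed

end
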